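(* Let $A$ be an abelian group and let $Q$ be a bicyclic group. Then, for every action of $Q$ on $A$ by automorphisms, $B_0(A\rtimes Q)=0$. (No finiteness is assumed.)
   Context: A group is bicyclic if it is cyclic or a direct product of two cyclic groups, each of which may be finite or infinite. For a group $G$, $M(G)=H_2(G,\mathbb Z)$, and $M_0(G)\le M(G)$ is the sum of the images of all maps $H_2(B,\mathbb Z)\to H_2(G,\mathbb Z)$ induced by inclusion, as $B$ runs through all abelian subgroups of $G$; equivalently, $M_0(G)$ is generated by the classes of the cycles $[x\mid y]-[y\mid x]$ (normalized bar complex) for commuting $x,y\in G$. The Bogomolov multiplier is $B_0(G)=M(G)/M_0(G)$. *)

theory Defs
  imports "HOL-Algebra.Free_Abelian_Groups" "HOL-Algebra.Elementary_Groups" "HOL-Algebra.Bij"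
begin

section \<open>Integral group homology via the normalized bar complex\<close>

text \<open>
  The chain group in degree n is free abelian on the cells \<open>[g\<^sub>1|...|g\<^sub>n]\<close>, encoded as lists of
  length n, with no entry equal to the identity. This is the quotient of the unnormalized bar
  chains by the degenerate cells, so a cell with an entry \<open>\<one>\<close> has to be read as 0;
  \<open>bar_cell\<close> does this.
\<close>

definition bar_cells :: "nat \<Rightarrow> ('a, 'm) monoid_scheme \<Rightarrow> 'a list set" where
  "bar_cells n G = {gs. length gs = n \<and> set gs \<subseteq> carrier G - {\<one>\<^bsub>G\<^esub>}}"

definition bar_chains :: "nat \<Rightarrow> ('a, 'm) monoid_scheme \<Rightarrow> ('a list \<Rightarrow>\<^sub>0 int) monoid" where
  "bar_chains n G = free_Abelian_group (bar_cells n G)"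

definition bar_cell :: "('a, 'm) monoid_scheme \<Rightarrow> 'a list \<Rightarrow> ('a list \<Rightarrow>\<^sub>0 int)" where
  "bar_cell G gs = (if \<one>\<^bsub>G\<^esub> \<in> set gs then 0 else frag_of gs)"

text \<open>
  For a cell of length n, face 0 deletes the first entry, face n deletes the last one, and
  face i with \<open>0 < i < n\<close> multiplies the i-th and (i+1)-st entries (counted from 1).
\<close>

definition bar_face :: "('a, 'm) monoid_scheme \<Rightarrow> nat \<Rightarrow> 'a list \<Rightarrow> 'a list" where
  "bar_face G i gs =
     (if i = 0 then tl gs
      else if i = length gs then butlast gs
      else take (i - 1) gs @ (gs ! (i - 1) \<otimes>\<^bsub>G\<^esub> gs ! i) # drop (i + 1) gs)"

definition bar_boundary :: "('a, 'm) monoid_scheme \<Rightarrow> ('a list \<Rightarrow>\<^sub>0 int) \<Rightarrow> ('a list \<Rightarrow>\<^sub>0 int)" where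
  "bar_boundary G =
     frag_extend (\<lambda>gs. if gs = [] then 0
       else \<Sum>i\<le>length gs. frag_cmul ((-1) ^ i) (bar_cell G (bar_face G i gs)))"

definition bar_cycle_group :: "nat \<Rightarrow> ('a, 'm) monoid_scheme \<Rightarrow> ('a list \<Rightarrow>\<^sub>0 int) monoid" where
  "bar_cycle_group n G =
     (bar_chains n G)\<lparr>carrier := {c \<in> carrier (bar_chains n G). bar_boundary G c = 0}\<rparr>"

definition bar_boundaries :: "nat \<Rightarrow> ('a, 'm) monoid_scheme \<Rightarrow> ('a list \<Rightarrow>\<^sub>0 int) set" where
  "bar_boundaries n G = bar_boundary G ` carrier (bar_chains (Suc n) G)"

definition grp_homology :: "nat \<Rightarrow> ('a, 'm) monoid_scheme \<Rightarrow> ('a list \<Rightarrow>\<^sub>0 int) set monoid" where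
  "grp_homology n G = bar_cycle_group n G Mod bar_boundaries n G"

text \<open>
  The map induced on homology by a homomorphism \<open>f\<close> from \<open>H\<close> to \<open>G\<close>: all representatives \<open>c\<close> of a
  homology class \<open>h\<close> have images in one and the same coset, which \<open>the_elem\<close> selects.
\<close>

definition grp_homology_induced ::
  "nat \<Rightarrow> ('a, 'm) monoid_scheme \<Rightarrow> ('b, 'n) monoid_scheme \<Rightarrow> ('a \<Rightarrow> 'b) \<Rightarrow>
    ('a list \<Rightarrow>\<^sub>0 int) set \<Rightarrow> ('b list \<Rightarrow>\<^sub>0 int) set" where
  "grp_homology_induced n H G f h =
     the_elem ((\<lambda>c. bar_boundaries n G #>\<^bsub>bar_cycle_group n G\<^esub>
                      frag_extend (\<lambda>gs. bar_cell G (map f gs)) c) ` h)"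


section \<open>The Bogomolov multiplier\<close>

definition schur_multiplier :: "('a, 'm) monoid_scheme \<Rightarrow> ('a list \<Rightarrow>\<^sub>0 int) set monoid" where
  "schur_multiplier G = grp_homology 2 G"

definition schur_multiplier_ab :: "('a, 'm) monoid_scheme \<Rightarrow> ('a list \<Rightarrow>\<^sub>0 int) set set" where
  "schur_multiplier_ab G =
     generate (schur_multiplier G)
       (\<Union>B \<in> {B. subgroup B G \<and> comm_group (G\<lparr>carrier := B\<rparr>)}.
          grp_homology_induced 2 (G\<lparr>carrier := B\<rparr>) G (\<lambda>x. x) `
            carrier (grp_homology 2 (G\<lparr>carrier := B\<rparr>)))"

definition bogomolov_multiplier :: "('a, 'm) monoid_scheme \<Rightarrow> ('a list \<Rightarrow>\<^sub>0 int) set set monoid" where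
  "bogomolov_multiplier G = schur_multiplier G Mod schur_multiplier_ab G"


section \<open>Bicyclic groups and semidirect products\<close>

text \<open>
  Taking the two cyclic factors over the element type of \<open>Q\<close> is no restriction: if \<open>Q\<close> is isomorphic
  to a direct product of cyclic groups of any types, the factors embed into \<open>Q\<close>.
\<close>

definition bicyclic_group :: "('a, 'm) monoid_scheme \<Rightarrow> bool" where
  "bicyclic_group Q \<longleftrightarrow> group Q \<and>
     (cyclic_group Q \<or>
      (\<exists>(C :: 'a monoid) (D :: 'a monoid).
         group C \<and> cyclic_group C \<and> group D \<and> cyclic_group D \<and> Q \<cong> C \<times>\<times> D))"

text \<open>
  Here \<open>\<phi>\<close> is a left action, that is, a homomorphism from \<open>Q\<close> to \<open>AutoGroup A\<close>.
\<close>

definition semidirect_product ::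
  "('a, 'm) monoid_scheme \<Rightarrow> ('b, 'n) monoid_scheme \<Rightarrow> ('b \<Rightarrow> 'a \<Rightarrow> 'a) \<Rightarrow> ('a \<times> 'b) monoid" where
  "semidirect_product A Q \<phi> =
     \<lparr>carrier = carrier A \<times> carrier Q,
      mult = (\<lambda>(a, q) (a', q'). (a \<otimes>\<^bsub>A\<^esub> \<phi> q a', q \<otimes>\<^bsub>Q\<^esub> q')),
      one = (\<one>\<^bsub>A\<^esub>, \<one>\<^bsub>Q\<^esub>)\<rparr>"

end

theory Submission
  imports Defs
begin

text \<open>
  Let \<open>G = A \<rtimes> Q\<close>, and let \<open>N\<close> be the group of 2-cycles with class in \<open>M\<^sub>0(G)\<close>. Reducing
  \<open>[x|y]\<close> modulo \<open>N\<close> gives a 2-cocycle with values in \<open>K = C\<^sub>2/N\<close> which is symmetric on commuting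
  pairs, so in the central extension \<open>E\<close> of \<open>G\<close> by \<open>K\<close> lifts of commuting elements commute.
  Hence the preimage \<open>B\<close> of \<open>A\<close> in \<open>E\<close> is abelian, and generators \<open>s\<close>, \<open>t\<close> of \<open>Q\<close> lift
  to commuting elements \<open>S\<close>, \<open>T\<close>. Since \<open>E\<close> is generated by \<open>B\<close>, \<open>S\<close> and \<open>T\<close>, its derived subgroup
  is \<open>(S - 1)B + (T - 1)B\<close>, so each of its elements is a single commutator
  \<open>[aS, bT]\<close>. If that commutator dies in \<open>G\<close>, then the images of \<open>aS\<close> and \<open>bT\<close> commute, thus so do
  \<open>aS\<close> and \<open>bT\<close>, that is, \<open>K \<inter> [E, E] = 1\<close>. But a 2-cycle \<open>z\<close>, read in \<open>K\<close>, lies in \<open>[E, E]\<close>, so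
  \<open>z \<in> N\<close>.
\<close>

section \<open>Commutators in split abelian-by-bicyclic groups\<close>

definition (in group) commutator :: "'a \<Rightarrow> 'a \<Rightarrow> 'a" where
  "commutator x y = x \<otimes> y \<otimes> inv x \<otimes> inv y"

context group
begin

lemma inv_mult_cancel [simp]:
  assumes "x \<in> carrier G" "y \<in> carrier G"
  shows "inv x \<otimes> (x \<otimes> y) = y" "x \<otimes> (inv x \<otimes> y) = y"
  using assms by (simp_all flip: m_assoc)

lemma commutator_closed [simp]:
  "\<lbrakk>x \<in> carrier G; y \<in> carrier G\<rbrakk> \<Longrightarrow> commutator x y \<in> carrier G"
  by (simp add: commutator_def)

lemma commutator_eq_one_iff:
  assumes "x \<in> carrier G" "y \<in> carrier G"
  shows "commutator x y = \<one> \<longleftrightarrow> x \<otimes> y = y \<otimes> x"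
proof -
  have "commutator x y = (x \<otimes> y) \<otimes> inv (y \<otimes> x)"
    using assms by (simp add: commutator_def inv_mult_group m_assoc)
  then show ?thesis
    using assms by (metis inv_closed inv_equality inv_inv m_closed r_inv)
qed

lemma inv_commutator:
  "\<lbrakk>x \<in> carrier G; y \<in> carrier G\<rbrakk> \<Longrightarrow> inv (commutator x y) = commutator y x"
  by (simp add: commutator_def inv_mult_group m_assoc)

text \<open>Modulo the normal subgroup \<open>D\<close>, the elements commuting with
  \<open>y\<close> form a centralizer, hence a subgroup. In \<open>G\<close> this is the identity
  \<open>[x x', y] = (x [x', y] inv x) [x, y]\<close> together with its analogue for
  inverses.\<close>

lemma commutator_generate_left:
  assumes "D \<lhd> G" "X \<subseteq> carrier G" "y \<in> carrier G"
    and X: "\<And>x. x \<in> X \<Longrightarrow> commutator x y \<in> D"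
    and "x \<in> generate G X"
  shows "commutator x y \<in> D"
  using \<open>x \<in> generate G X\<close>
proof induction
  interpret D: normal D G by fact
  have conj: "g \<otimes> d \<otimes> inv g \<in> D" if "g \<in> carrier G" "d \<in> D" for g d
    using that by (rule D.inv_op_closed2)
  {
    case one
    have "commutator \<one> y = \<one>" using assms by (simp add: commutator_def)
    then show ?case by simp
  next
    case (incl x)
    then show ?case by (rule X)
  next
    case (inv x)
    then have x: "x \<in> carrier G" using assms by blast
    have "commutator (inv x) y = inv x \<otimes> inv (commutator x y) \<otimes> inv (inv x)"
      using x assms by (simp add: commutator_def inv_mult_group m_assoc)
    also have "\<dots> \<in> D"
      using x X[OF inv] by (intro conj) auto
    finally show ?case .
  next
    case (eng x x')
    then have x: "x \<in> carrier G" "x' \<in> carrier G"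
      using generate_in_carrier assms by blast+
    have "commutator (x \<otimes> x') y = (x \<otimes> commutator x' y \<otimes> inv x) \<otimes> commutator x y"
      using x assms by (simp add: commutator_def inv_mult_group m_assoc)
    also have "\<dots> \<in> D"
      using x eng.IH conj by simp
    finally show ?case .
  }
qed

text \<open>The test on generators is applied to the left argument, turned around by
  \<open>inv_commutator\<close>, and applied to the left argument again.\<close>

lemma derived_generate_subset:
  assumes D: "D \<lhd> G" and X: "X \<subseteq> carrier G" "carrier G = generate G X"
    and XX: "\<And>x y. \<lbrakk>x \<in> X; y \<in> X\<rbrakk> \<Longrightarrow> commutator x y \<in> D"
  shows "derived G (carrier G) \<subseteq> D"
proof -
  interpret D: normal D G by (rule D)
  have 1: "commutator x y \<in> D" if "x \<in> carrier G" "y \<in> X" for x y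
    using commutator_generate_left[OF D X(1), of y x] that X XX by blast
  have 2: "commutator y x \<in> D" if "x \<in> carrier G" "y \<in> X" for x y
    using 1[OF that] that inv_commutator[of x y] X(1) D.m_inv_closed by fastforce
  have "commutator x y \<in> D" if "x \<in> carrier G" "y \<in> carrier G" for x y
    using commutator_generate_left[OF D X(1), of y x] that X 2 by blast
  then have "derived_set G (carrier G) \<subseteq> D"
    by (auto simp: commutator_def)
  then show ?thesis
    unfolding derived_def by (rule generate_subgroup_incl[OF _ D.subgroup_axioms])
qed

end

text \<open>The quotient by \<open>B\<close> is abelian and generated by the images of
  \<open>S\<close> and \<open>T\<close>; the splitting enters as the commuting of these two lifts.
  In this form the hypotheses pass to the central extensions below, where \<open>B\<close> may fail
  to have a complement.\<close>

locale abelian_by_bicyclic = normal B G for B and G (structure) +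
  fixes S T
  assumes abelian: "\<lbrakk>x \<in> B; y \<in> B\<rbrakk> \<Longrightarrow> x \<otimes> y = y \<otimes> x"
    and commutator_mem: "\<lbrakk>x \<in> carrier G; y \<in> carrier G\<rbrakk> \<Longrightarrow> commutator x y \<in> B"
    and S: "S \<in> carrier G" and T: "T \<in> carrier G" and ST: "S \<otimes> T = T \<otimes> S"
    and gen: "carrier G = generate G (B \<union> {S, T})"

text \<open>The commutator of \<open>a \<otimes> S\<close> and \<open>b \<otimes> T\<close> depends
  on the pair \<open>(a, b)\<close> through a homomorphism from \<open>B \<times> B\<close> to
  \<open>B\<close>, so these commutators already form a subgroup. It is normal and contains all
  commutators of the generators, so it contains the derived subgroup.\<close>

lemma (in abelian_by_bicyclic) derived_subset_commutators:
  "derived G (carrier G) \<subseteq> {commutator (a \<otimes> S) (b \<otimes> T) |a b. a \<in> B \<and> b \<in> B}"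
proof -
  have one_B: "\<one> \<in> B"
    by (rule subgroup.one_closed[OF subgroup_axioms])
  have Bc [simp]: "b \<in> B \<Longrightarrow> b \<in> carrier G" for b
    using subset by blast
  define c where "c g b = g \<otimes> b \<otimes> inv g" for g b
  have cB [simp]: "c g b \<in> B" if "g \<in> carrier G" "b \<in> B" for g b
    using that by (simp add: c_def inv_op_closed2)
  have c_mult: "c g (a \<otimes> b) = c g a \<otimes> c g b"
    if "g \<in> carrier G" "a \<in> B" "b \<in> B" for g a b
    using that by (simp add: c_def m_assoc)
  have c_inv: "c g (inv a) = inv (c g a)" if "g \<in> carrier G" "a \<in> B" for g a
    using that by (simp add: c_def m_assoc inv_mult_group)
  have c_comp: "c g (c k b) = c (g \<otimes> k) b"
    if "g \<in> carrier G" "k \<in> carrier G" "b \<in> B" for g k b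
    using that by (simp add: c_def m_assoc inv_mult_group)
  have c_triv: "c a b = b" if "a \<in> B" "b \<in> B" for a b
    using that abelian[of a b] by (simp add: c_def m_assoc)
  \<comment> \<open>Conjugation on \<open>B\<close> factors through the abelian quotient by
    \<open>B\<close>: the commutator of \<open>g\<close> and \<open>k\<close> lies in
    \<open>B\<close> and therefore acts trivially on the abelian group \<open>B\<close>.\<close>
  have c_comm: "c g (c k b) = c k (c g b)"
    if "g \<in> carrier G" "k \<in> carrier G" "b \<in> B" for g k b
  proof -
    have "c (commutator g k) (c (k \<otimes> g) b) = c (g \<otimes> k) b"
      using that by (simp add: c_comp commutator_def m_assoc)
    then show ?thesis
      using that by (simp add: c_comp c_triv commutator_mem)
  qed
  have lcomm: "x \<otimes> (y \<otimes> z) = y \<otimes> (x \<otimes> z)" if "x \<in> B" "y \<in> B" "z \<in> B" for x y z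
    using that abelian[of x y] by (simp flip: m_assoc)
  \<comment> \<open>In additive notation, \<open>d a b = (S - 1) b - (T - 1) a\<close>.\<close>
  define d where "d a b = a \<otimes> c S b \<otimes> inv (c T a) \<otimes> inv b" for a b
  have dB: "d a b \<in> B" if "a \<in> B" "b \<in> B" for a b
    using that S T by (simp add: d_def)
  have d_comm: "commutator (a \<otimes> S) (b \<otimes> T) = d a b" if "a \<in> B" "b \<in> B" for a b
  proof -
    \<comment> \<open>\<open>T\<close> commutes with \<open>inv S\<close>, in a form that rewrites
      right-nested products.\<close>
    have "T \<otimes> (inv S \<otimes> x) = inv S \<otimes> (T \<otimes> x)" if "x \<in> carrier G" for x
    proof -
      have "inv S \<otimes> ((S \<otimes> T) \<otimes> (inv S \<otimes> x)) = inv S \<otimes> (T \<otimes> x)"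
        unfolding ST using that S T by (simp add: m_assoc)
      then show ?thesis
        using that S T by (simp add: m_assoc)
    qed
    then show ?thesis
      using that S T by (simp add: commutator_def d_def c_def m_assoc inv_mult_group)
  qed
  have d_mult: "d a b \<otimes> d a' b' = d (a \<otimes> a') (b \<otimes> b')"
    if "a \<in> B" "b \<in> B" "a' \<in> B" "b' \<in> B" for a b a' b'
    using that S T
    by (simp add: d_def c_mult inv_mult_group m_assoc lcomm abelian)
  have d_inv: "inv (d a b) = d (inv a) (inv b)" if "a \<in> B" "b \<in> B" for a b
    using that S T
    by (simp add: d_def c_inv inv_mult_group m_assoc lcomm abelian)
  have d_conj: "c g (d a b) = d (c g a) (c g b)" if "g \<in> carrier G" "a \<in> B" "b \<in> B" for g a b
    using that S T
    by (simp add: d_def c_mult c_inv c_comm[of g])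
  define D where "D = {d a b |a b. a \<in> B \<and> b \<in> B}"
  have D_eq: "{commutator (a \<otimes> S) (b \<otimes> T) |a b. a \<in> B \<and> b \<in> B} = D"
    unfolding D_def using d_comm by (metis (lifting))
  have dD: "d a b \<in> D" if "a \<in> B" "b \<in> B" for a b
    unfolding D_def using that by blast
  have D_E: "\<exists>a b. x = d a b \<and> a \<in> B \<and> b \<in> B" if "x \<in> D" for x
    using that unfolding D_def by blast
  have "subgroup D G"
  proof (rule subgroupI)
    show "D \<noteq> {}"
      using dD[OF one_B one_B] by blast
    show "D \<subseteq> carrier G"
      using D_E dB by force
    show "inv x \<in> D" if x: "x \<in> D" for x
    proof -
      obtain a b where "x = d a b" "a \<in> B" "b \<in> B"
        using D_E[OF x] by blast
      then show ?thesis using dD d_inv by simp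
    qed
    show "x \<otimes> y \<in> D" if xy: "x \<in> D" "y \<in> D" for x y
    proof -
      obtain a b a' b' where "x = d a b" "y = d a' b'" "a \<in> B" "b \<in> B" "a' \<in> B" "b' \<in> B"
        using D_E[OF xy(1)] D_E[OF xy(2)] by metis
      then show ?thesis using dD d_mult by simp
    qed
  qed
  moreover have "g \<otimes> x \<otimes> inv g \<in> D" if g: "g \<in> carrier G" and x: "x \<in> D" for g x
  proof -
    obtain a b where ab: "x = d a b" "a \<in> B" "b \<in> B"
      using D_E[OF x] by blast
    have "g \<otimes> x \<otimes> inv g = d (c g a) (c g b)"
      using d_conj[OF g ab(2,3)] by (simp add: c_def ab(1))
    then show ?thesis using g ab dD by simp
  qed
  ultimately have normal: "D \<lhd> G"
    unfolding normal_inv_iff by blast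
  \<comment> \<open>A trivial argument of \<open>d\<close> gives the commutators of elements of
    \<open>B\<close> with \<open>S\<close> and with \<open>T\<close>; inverses give those in the
    opposite order. All other pairs of generators commute.\<close>
  have d1: "d \<one> b = commutator S b" "d b \<one> = commutator b T" if "b \<in> B" for b
    using that S T by (simp_all add: d_def c_def commutator_def m_assoc inv_mult_group)
  have "commutator x y \<in> D" if "x \<in> B \<union> {S, T}" "y \<in> B \<union> {S, T}" for x y
  proof -
    interpret D: normal D G by (rule normal)
    have one: "\<one> \<in> D" by (rule subgroup.one_closed[OF D.subgroup_axioms])
    have bS: "commutator S b \<in> D" "commutator b T \<in> D" if "b \<in> B" for b
      using d1[OF that, symmetric] dD that one_B by auto
    have Sb: "commutator b S \<in> D" "commutator T b \<in> D" if "b \<in> B" for b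
      using D.m_inv_closed[OF bS(1)] D.m_inv_closed[OF bS(2)] that S T
      by (simp_all add: inv_commutator)
    show ?thesis
    proof (cases "x \<otimes> y = y \<otimes> x")
      case True
      then have "commutator x y = \<one>"
        using that S T by (subst commutator_eq_one_iff) auto
      then show ?thesis using one by simp
    next
      case False
      then show ?thesis
        using that ST abelian bS Sb by auto
    qed
  qed
  then show ?thesis
    unfolding D_eq using derived_generate_subset[OF normal _ gen] S T subset by simp
qed

section \<open>Central extensions in which commuting pairs lift\<close>

locale two_cocycle = K: comm_group K + group G for K :: "('a, 'm) monoid_scheme" and G :: "('b, 'n) monoid_scheme" (structure) +
  fixes f :: "'b \<Rightarrow> 'b \<Rightarrow> 'a"
  assumes f_closed [simp]: "\<lbrakk>x \<in> carrier G; y \<in> carrier G\<rbrakk> \<Longrightarrow> f x y \<in> carrier K"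
    and f_one [simp]: "x \<in> carrier G \<Longrightarrow> f x \<one>\<^bsub>G\<^esub> = \<one>\<^bsub>K\<^esub>" "x \<in> carrier G \<Longrightarrow> f \<one>\<^bsub>G\<^esub> x = \<one>\<^bsub>K\<^esub>"
    and cocycle: "\<lbrakk>x \<in> carrier G; y \<in> carrier G; z \<in> carrier G\<rbrakk> \<Longrightarrow>
      f x y \<otimes>\<^bsub>K\<^esub> f (x \<otimes>\<^bsub>G\<^esub> y) z = f y z \<otimes>\<^bsub>K\<^esub> f x (y \<otimes>\<^bsub>G\<^esub> z)"
begin

text \<open>The central extension of \<open>G\<close> by \<open>K\<close> with class
  \<open>f\<close>: the map \<open>x \<mapsto> (\<one>, x)\<close> is a section of the projection,
  and \<open>f\<close> measures its failure to be multiplicative.\<close>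

definition ext :: "('a \<times> 'b) monoid" where
  "ext = \<lparr>carrier = carrier K \<times> carrier G,
     mult = (\<lambda>(u, x) (v, y). (u \<otimes>\<^bsub>K\<^esub> v \<otimes>\<^bsub>K\<^esub> f x y, x \<otimes>\<^bsub>G\<^esub> y)),
     one = (\<one>\<^bsub>K\<^esub>, \<one>\<^bsub>G\<^esub>)\<rparr>"

lemma ext_simps [simp]:
  "carrier ext = carrier K \<times> carrier G"
  "(u, x) \<otimes>\<^bsub>ext\<^esub> (v, y) = (u \<otimes>\<^bsub>K\<^esub> v \<otimes>\<^bsub>K\<^esub> f x y, x \<otimes>\<^bsub>G\<^esub> y)"
  "\<one>\<^bsub>ext\<^esub> = (\<one>\<^bsub>K\<^esub>, \<one>\<^bsub>G\<^esub>)"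
  by (simp_all add: ext_def)

text \<open>Associativity is the cocycle identity, and normalization of \<open>f\<close> makes
  \<open>(\<one>, \<one>)\<close> neutral.\<close>

lemma group_ext: "group ext"
proof (rule groupI)
  fix p q r assume "p \<in> carrier ext" "q \<in> carrier ext" "r \<in> carrier ext"
  moreover obtain u x v y w z where "p = (u, x)" "q = (v, y)" "r = (w, z)"
    by (metis surj_pair)
  ultimately show "p \<otimes>\<^bsub>ext\<^esub> q \<otimes>\<^bsub>ext\<^esub> r = p \<otimes>\<^bsub>ext\<^esub> (q \<otimes>\<^bsub>ext\<^esub> r)"
    using cocycle[of x y z] by (simp add: m_assoc K.m_ac)
next
  fix p assume p: "p \<in> carrier ext"
  obtain u x where [simp]: "p = (u, x)" by fastforce
  \<comment> \<open>The solution \<open>v\<close> of \<open>v u f(inv x, x) = \<one>\<close>, which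
    is the \<open>K\<close>-component of the equation for a left inverse.\<close>
  let ?v = "inv\<^bsub>K\<^esub> (u \<otimes>\<^bsub>K\<^esub> f (inv\<^bsub>G\<^esub> x) x)"
  have "(?v, inv\<^bsub>G\<^esub> x) \<otimes>\<^bsub>ext\<^esub> p = \<one>\<^bsub>ext\<^esub>"
    using p by (simp add: K.m_assoc)
  then show "\<exists>q \<in> carrier ext. q \<otimes>\<^bsub>ext\<^esub> p = \<one>\<^bsub>ext\<^esub>"
    using p by (intro bexI[of _ "(?v, inv\<^bsub>G\<^esub> x)"]) auto
qed auto

sublocale E: group ext
  by (rule group_ext)

sublocale proj: group_hom ext G snd
  by unfold_locales (auto simp: hom_def)

lemma snd_commutator:
  "\<lbrakk>X \<in> carrier ext; Y \<in> carrier ext\<rbrakk> \<Longrightarrow>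
    snd (E.commutator X Y) = commutator (snd X) (snd Y)"
  unfolding E.commutator_def commutator_def
  by (simp only: proj.hom_mult proj.hom_inv E.m_closed E.inv_closed)

end

section \<open>Cocycles that are symmetric on commuting pairs\<close>

locale commuting_two_cocycle = two_cocycle +
  assumes f_commute: "\<lbrakk>x \<in> carrier G; y \<in> carrier G; x \<otimes>\<^bsub>G\<^esub> y = y \<otimes>\<^bsub>G\<^esub> x\<rbrakk> \<Longrightarrow> f x y = f y x"
begin

text \<open>The \<open>K\<close>-components of the two products are \<open>u v f(x, y)\<close> and
  \<open>v u f(y, x)\<close>.\<close>

lemma ext_commute:
  assumes "X \<in> carrier ext" "Y \<in> carrier ext" "snd X \<otimes>\<^bsub>G\<^esub> snd Y = snd Y \<otimes>\<^bsub>G\<^esub> snd X"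
  shows "X \<otimes>\<^bsub>ext\<^esub> Y = Y \<otimes>\<^bsub>ext\<^esub> X"
proof -
  obtain u x v y where "X = (u, x)" "Y = (v, y)" by fastforce
  then show ?thesis
    using assms f_commute[of x y] by (simp add: K.m_comm[of u v])
qed

text \<open>The structure is pulled back along the projection to \<open>G\<close>. All required
  commuting relations lift by \<open>ext_commute\<close>, and generation lifts because the preimage
  of \<open>B\<close> contains the kernel \<open>K\<close>.\<close>

lemma abelian_by_bicyclic_ext:
  assumes "abelian_by_bicyclic B G S T"
  shows "abelian_by_bicyclic (carrier K \<times> B) ext (\<one>\<^bsub>K\<^esub>, S) (\<one>\<^bsub>K\<^esub>, T)"
proof -
  interpret B: abelian_by_bicyclic B G S T by fact
  note [simp] = B.S B.T
  have one_B: "\<one>\<^bsub>G\<^esub> \<in> B"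
    by (rule subgroup.one_closed[OF B.subgroup_axioms])
  have Bc [simp]: "b \<in> B \<Longrightarrow> b \<in> carrier G" for b
    using B.subset by blast
  have pre: "X \<in> carrier K \<times> B \<longleftrightarrow> X \<in> carrier ext \<and> snd X \<in> B" for X
    by (cases X) auto
  have "subgroup (carrier K \<times> B) ext"
  proof (rule E.subgroupI)
    show "carrier K \<times> B \<noteq> {}"
      using one_B K.one_closed by blast
    show "inv\<^bsub>ext\<^esub> X \<in> carrier K \<times> B" if "X \<in> carrier K \<times> B" for X
      using that unfolding pre by (metis E.inv_closed proj.hom_inv B.m_inv_closed)
  qed auto
  moreover have "X \<otimes>\<^bsub>ext\<^esub> Y \<otimes>\<^bsub>ext\<^esub> inv\<^bsub>ext\<^esub> X \<in> carrier K \<times> B"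
    if "X \<in> carrier ext" "Y \<in> carrier K \<times> B" for X Y
    using that unfolding pre
    by (metis E.inv_closed E.m_closed proj.hom_inv proj.hom_mult proj.hom_closed B.inv_op_closed2)
  ultimately have normal: "carrier K \<times> B \<lhd> ext"
    unfolding E.normal_inv_iff by blast
  let ?X = "carrier K \<times> B \<union> {(\<one>\<^bsub>K\<^esub>, S), (\<one>\<^bsub>K\<^esub>, T)}"
  have sub: "?X \<subseteq> carrier ext" by auto
  interpret gen: subgroup "generate ext ?X" ext
    by (rule E.generate_is_subgroup[OF sub])
  have X_incl: "X \<in> generate ext ?X" if "X \<in> ?X" for X
    using that by (rule generate.incl)
  have lift: "(u, x) \<in> generate ext ?X" if "x \<in> B \<union> {S, T}" "u \<in> carrier K" for u x
  proof (cases "x \<in> B")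
    case False
    then have "(\<one>\<^bsub>K\<^esub>, x) \<in> ?X" using that by auto
    moreover have "(u, \<one>\<^bsub>G\<^esub>) \<in> ?X" using that one_B by auto
    ultimately have "(u, \<one>\<^bsub>G\<^esub>) \<otimes>\<^bsub>ext\<^esub> (\<one>\<^bsub>K\<^esub>, x) \<in> generate ext ?X"
      by (intro gen.m_closed X_incl)
    moreover have "(u, \<one>\<^bsub>G\<^esub>) \<otimes>\<^bsub>ext\<^esub> (\<one>\<^bsub>K\<^esub>, x) = (u, x)"
      using that by auto
    ultimately show ?thesis by simp
  qed (use that X_incl in auto)
  \<comment> \<open>The induction treats the whole fibre over \<open>x\<close> at once, since the
    inverse and product steps change the \<open>K\<close>-component.\<close>
  have "(u, x) \<in> generate ext ?X" if "x \<in> generate G (B \<union> {S, T})" "u \<in> carrier K" for u x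
    using that
  proof (induction arbitrary: u)
    case one
    then show ?case using lift one_B by auto
  next
    case (incl x)
    then show ?case using lift by auto
  next
    case (inv x)
    then have x: "x \<in> carrier G" by auto
    \<comment> \<open>\<open>Y\<close> lies over the generator \<open>x\<close> itself, so
      \<open>lift\<close> applies to it, and \<open>(u, inv x)\<close> is its inverse.\<close>
    define Y where "Y = inv\<^bsub>ext\<^esub> (u, inv\<^bsub>G\<^esub> x)"
    have Y: "Y \<in> carrier ext" "snd Y = x"
      using x inv.prems E.inv_closed[of "(u, inv\<^bsub>G\<^esub> x)"] proj.hom_inv[of "(u, inv\<^bsub>G\<^esub> x)"]
      by (simp_all add: Y_def)
    then have "Y \<in> generate ext ?X"
      using lift[of x "fst Y"] inv.hyps by (cases Y) auto
    then have "inv\<^bsub>ext\<^esub> Y \<in> generate ext ?X"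
      by (rule gen.m_inv_closed)
    then show ?case
      using x inv.prems by (simp add: Y_def)
  next
    case (eng x y)
    then have xy: "x \<in> carrier G" "y \<in> carrier G"
      using B.gen by blast+
    \<comment> \<open>The factor \<open>inv (f x y)\<close> cancels the cocycle term, so that the
      product is \<open>(u, x y)\<close>.\<close>
    have "(u \<otimes>\<^bsub>K\<^esub> inv\<^bsub>K\<^esub> f x y, x) \<otimes>\<^bsub>ext\<^esub> (\<one>\<^bsub>K\<^esub>, y) \<in> generate ext ?X"
      using eng xy by (intro gen.m_closed) auto
    then show ?case
      using eng.prems xy by (simp add: K.m_assoc)
  qed
  then have gen: "carrier ext = generate ext ?X"
    using gen.subset unfolding B.gen[symmetric] by fastforce
  show ?thesis
  proof (intro abelian_by_bicyclic.intro normal abelian_by_bicyclic_axioms.intro gen)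
    show "X \<otimes>\<^bsub>ext\<^esub> Y = Y \<otimes>\<^bsub>ext\<^esub> X" if "X \<in> carrier K \<times> B" "Y \<in> carrier K \<times> B" for X Y
      using that by (intro ext_commute) (auto simp: B.abelian)
    show "E.commutator X Y \<in> carrier K \<times> B" if "X \<in> carrier ext" "Y \<in> carrier ext" for X Y
      using that unfolding pre
      by (simp add: snd_commutator B.commutator_mem del: ext_simps)
    show "(\<one>\<^bsub>K\<^esub>, S) \<otimes>\<^bsub>ext\<^esub> (\<one>\<^bsub>K\<^esub>, T) = (\<one>\<^bsub>K\<^esub>, T) \<otimes>\<^bsub>ext\<^esub> (\<one>\<^bsub>K\<^esub>, S)"
      by (rule ext_commute) (auto simp: B.ST)
  qed auto
qed

text \<open>It is essential that \<open>X\<close> is one commutator: triviality of its image then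
  says that two elements of \<open>G\<close> commute, to which \<open>ext_commute\<close> applies. A
  product of several commutators would give no such pair.\<close>

lemma kernel_inter_derived:
  assumes "abelian_by_bicyclic B G S T"
    and X: "X \<in> derived ext (carrier ext)" "snd X = \<one>\<^bsub>G\<^esub>"
  shows "X = \<one>\<^bsub>ext\<^esub>"
proof -
  interpret B: abelian_by_bicyclic "carrier K \<times> B" ext "(\<one>\<^bsub>K\<^esub>, S)" "(\<one>\<^bsub>K\<^esub>, T)"
    by (rule abelian_by_bicyclic_ext) fact
  obtain a b where ab: "a \<in> carrier K \<times> B" "b \<in> carrier K \<times> B"
    and X_eq: "X = E.commutator (a \<otimes>\<^bsub>ext\<^esub> (\<one>\<^bsub>K\<^esub>, S)) (b \<otimes>\<^bsub>ext\<^esub> (\<one>\<^bsub>K\<^esub>, T))"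
    using B.derived_subset_commutators X(1) by blast
  define Y Z where "Y = a \<otimes>\<^bsub>ext\<^esub> (\<one>\<^bsub>K\<^esub>, S)" and "Z = b \<otimes>\<^bsub>ext\<^esub> (\<one>\<^bsub>K\<^esub>, T)"
  have YZ: "Y \<in> carrier ext" "Z \<in> carrier ext"
    unfolding Y_def Z_def using ab B.S B.T B.subset by blast+
  then have "commutator (snd Y) (snd Z) = \<one>\<^bsub>G\<^esub>"
    using X(2) snd_commutator unfolding X_eq Y_def Z_def by simp
  then have "Y \<otimes>\<^bsub>ext\<^esub> Z = Z \<otimes>\<^bsub>ext\<^esub> Y"
    using YZ by (intro ext_commute) (auto simp: commutator_eq_one_iff)
  then show ?thesis
    using YZ E.commutator_eq_one_iff X_eq unfolding Y_def Z_def by simp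
qed

end

section \<open>Low-dimensional bar chains\<close>

lemma bar_cell_simps:
  "bar_cell G [x] = (if x = \<one>\<^bsub>G\<^esub> then 0 else frag_of [x])"
  "bar_cell G [x, y] = (if x = \<one>\<^bsub>G\<^esub> \<or> y = \<one>\<^bsub>G\<^esub> then 0 else frag_of [x, y])"
  by (auto simp: bar_cell_def)

text \<open>Faces involve only the multiplication and the identity, which a subgroup shares with
  \<open>G\<close>.\<close>

lemma bar_boundary_restrict [simp]: "bar_boundary (G\<lparr>carrier := B\<rparr>) = bar_boundary G"
  unfolding bar_boundary_def bar_cell_def bar_face_def by (simp cong: if_cong)

lemma bar_boundary_zero [simp]: "bar_boundary G 0 = 0"
  by (simp add: bar_boundary_def)

lemma bar_boundary_add: "bar_boundary G (c + c') = bar_boundary G c + bar_boundary G c'"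
  by (simp add: bar_boundary_def frag_extend_add)

lemma bar_boundary_diff: "bar_boundary G (c - c') = bar_boundary G c - bar_boundary G c'"
  by (simp add: bar_boundary_def frag_extend_diff)

lemma bar_boundary_minus: "bar_boundary G (- c) = - bar_boundary G c"
  by (simp add: bar_boundary_def frag_extend_minus)

lemma comm_group_bar_chains: "comm_group (bar_chains n G)"
  by (simp add: bar_chains_def abelian_free_Abelian_group)

lemma bar_chains_simps [simp]:
  "c \<in> carrier (bar_chains n G) \<longleftrightarrow> Poly_Mapping.keys c \<subseteq> bar_cells n G"
  "c \<otimes>\<^bsub>bar_chains n G\<^esub> c' = c + c'"
  "\<one>\<^bsub>bar_chains n G\<^esub> = 0"
  by (simp_all add: bar_chains_def)

lemma inv_bar_chains [simp]:
  "c \<in> carrier (bar_chains n G) \<Longrightarrow> inv\<^bsub>bar_chains n G\<^esub> c = - c"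
  by (simp add: bar_chains_def)

lemma bar_cells_2: "gs \<in> bar_cells 2 G \<longleftrightarrow>
    (\<exists>x y. gs = [x, y] \<and> x \<in> carrier G - {\<one>\<^bsub>G\<^esub>} \<and> y \<in> carrier G - {\<one>\<^bsub>G\<^esub>})"
  by (auto simp: bar_cells_def numeral_2_eq_2 length_Suc_conv)

lemma bar_cells_3: "gs \<in> bar_cells 3 G \<longleftrightarrow>
    (\<exists>x y z. gs = [x, y, z] \<and> x \<in> carrier G - {\<one>\<^bsub>G\<^esub>} \<and> y \<in> carrier G - {\<one>\<^bsub>G\<^esub>} \<and> z \<in> carrier G - {\<one>\<^bsub>G\<^esub>})"
  by (auto simp: bar_cells_def numeral_3_eq_3 length_Suc_conv)

lemma bar_cell_chain:
  "\<lbrakk>length gs = n; set gs \<subseteq> carrier G\<rbrakk> \<Longrightarrow> bar_cell G gs \<in> carrier (bar_chains n G)"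
  by (auto simp: bar_cell_def bar_cells_def)

text \<open>Stated for \<open>bar_cell\<close> so as to include degenerate cells: if
  \<open>x\<close> or \<open>y\<close> is the identity, the right-hand side cancels to 0. This
  spares case distinctions when two boundaries are composed.\<close>

lemma (in group) bar_boundary_cell_2:
  assumes "x \<in> carrier G" "y \<in> carrier G"
  shows "bar_boundary G (bar_cell G [x, y]) = bar_cell G [y] - bar_cell G [x \<otimes> y] + bar_cell G [x]"
  using assms
  by (auto simp: bar_boundary_def bar_cell_simps bar_face_def numeral_2_eq_2)

lemma bar_boundary_cell_3:
  "bar_boundary G (frag_of [x, y, z]) =
    bar_cell G [y, z] - bar_cell G [x \<otimes>\<^bsub>G\<^esub> y, z] + bar_cell G [x, y \<otimes>\<^bsub>G\<^esub> z] - bar_cell G [x, y]"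
  by (auto simp: bar_boundary_def bar_face_def numeral_3_eq_3)

lemma (in group) bar_face_carrier:
  assumes "length gs = Suc n" "set gs \<subseteq> carrier G" "i \<le> length gs"
  shows "length (bar_face G i gs) = n" "set (bar_face G i gs) \<subseteq> carrier G"
proof -
  show "length (bar_face G i gs) = n"
    using assms by (auto simp: bar_face_def)
  have "set (take k gs) \<subseteq> carrier G" "set (drop k gs) \<subseteq> carrier G" for k
    using assms(2) set_take_subset[of k gs] set_drop_subset[of k gs] by blast+
  moreover have "gs ! k \<in> carrier G" if "k < length gs" for k
    using that assms(2) nth_mem by blast
  moreover have "set (tl gs) \<subseteq> set gs" "set (butlast gs) \<subseteq> set gs"
    by (cases gs, auto dest: in_set_butlastD)
  then have "set (tl gs) \<subseteq> carrier G" "set (butlast gs) \<subseteq> carrier G"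
    using assms(2) by blast+
  ultimately show "set (bar_face G i gs) \<subseteq> carrier G"
    using assms(1,3) by (auto simp: bar_face_def)
qed

lemma (in group) bar_boundary_chain:
  assumes "c \<in> carrier (bar_chains (Suc n) G)"
  shows "bar_boundary G c \<in> carrier (bar_chains n G)"
proof -
  have "Poly_Mapping.keys (\<Sum>i\<le>length gs. frag_cmul ((-1) ^ i) (bar_cell G (bar_face G i gs)))
      \<subseteq> bar_cells n G" if "gs \<in> bar_cells (Suc n) G" for gs
  proof -
    have gs: "length gs = Suc n" "set gs \<subseteq> carrier G"
      using that by (auto simp: bar_cells_def)
    have "frag_cmul ((-1) ^ i) (bar_cell G (bar_face G i gs)) \<in> carrier (free_Abelian_group (bar_cells n G))"
      if "i \<le> length gs" for i
      using bar_cell_chain[OF bar_face_carrier[OF gs that]] keys_cmul by auto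
    then show ?thesis
      by (metis (no_types, lifting) atMost_iff carrier_free_Abelian_group_iff sum_closed_free_Abelian_group)
  qed
  moreover have "gs \<in> bar_cells (Suc n) G" if "gs \<in> Poly_Mapping.keys c" for gs
    using assms that by auto
  ultimately show ?thesis
    unfolding bar_boundary_def bar_chains_simps
    by (intro order_trans[OF keys_frag_extend] UN_least) auto
qed

lemma (in group) bar_boundary_boundary_3:
  assumes "c \<in> carrier (bar_chains 3 G)"
  shows "bar_boundary G (bar_boundary G c) = 0"
proof (rule free_Abelian_group_induct[where P = "\<lambda>c. bar_boundary G (bar_boundary G c) = 0"])
  show "Poly_Mapping.keys c \<subseteq> bar_cells 3 G"
    using assms by simp
next
  fix gs assume "gs \<in> bar_cells 3 G"
  then obtain x y z where gs: "gs = [x, y, z]"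
    and xyz: "x \<in> carrier G" "y \<in> carrier G" "z \<in> carrier G"
    unfolding bar_cells_3 by auto
  then show "bar_boundary G (bar_boundary G (frag_of gs)) = 0"
    by (simp add: bar_boundary_cell_3 bar_boundary_diff bar_boundary_add bar_boundary_cell_2 m_assoc)
qed (simp_all add: bar_boundary_diff)

lemma hom_free_Abelian_group_eq:
  assumes "group H" "h \<in> hom (free_Abelian_group S) H" "k \<in> hom (free_Abelian_group S) H"
    and eq: "\<And>s. s \<in> S \<Longrightarrow> h (frag_of s) = k (frag_of s)"
    and "c \<in> carrier (free_Abelian_group S)"
  shows "h c = k c"
proof -
  interpret H: group H by fact
  interpret h: group_hom "free_Abelian_group S" H h
    using assms group_free_Abelian_group by (simp add: group_hom_def group_hom_axioms_def)
  interpret k: group_hom "free_Abelian_group S" H k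
    using assms group_free_Abelian_group by (simp add: group_hom_def group_hom_axioms_def)
  have "Poly_Mapping.keys c \<subseteq> S"
    using assms(5) by simp
  then show ?thesis
  proof (rule free_Abelian_group_induct)
    show "h 0 = k 0"
      using h.hom_one k.hom_one by simp
  next
    fix x y
    assume 2: "Poly_Mapping.keys x \<subseteq> S" "Poly_Mapping.keys y \<subseteq> S" "h x = k x" "h y = k y"
    have "h (x - y) = h x \<otimes>\<^bsub>H\<^esub> inv\<^bsub>H\<^esub> h y" "k (x - y) = k x \<otimes>\<^bsub>H\<^esub> inv\<^bsub>H\<^esub> k y"
      using 2 h.hom_mult[of x "- y"] h.hom_inv[of y] k.hom_mult[of x "- y"] k.hom_inv[of y]
      by simp_all
    then show "h (x - y) = k (x - y)" using 2 by simp
  qed (use eq in auto)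
qed

text \<open>
  The two homomorphisms compared here send a 2-chain to the abelianization of the extension: one
  through \<open>K\<close>, the other through the boundary. They agree because
  \<open>(f x y, \<one>) = (\<one>, x) (\<one>, y) (\<one>, x y)\<^sup>-\<^sup>1\<close>.
\<close>

lemma (in two_cocycle) cycle_in_derived:
  assumes h: "h \<in> hom (bar_chains 2 G) K"
    and f: "\<And>x y. \<lbrakk>x \<in> carrier G; y \<in> carrier G\<rbrakk> \<Longrightarrow> h (bar_cell G [x, y]) = f x y"
    and c: "c \<in> carrier (bar_chains 2 G)" "bar_boundary G c = 0"
  shows "(h c, \<one>\<^bsub>G\<^esub>) \<in> derived ext (carrier ext)"
proof -
  let ?D = "derived ext (carrier ext)"
  let ?Q = "ext Mod ?D"
  interpret D: normal ?D ext by (rule E.derived_self_is_normal)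
  interpret Q: comm_group ?Q by (rule E.derived_quot_is_comm_group)
  \<comment> \<open>\<open>p\<close> is the abelianization map of the extension.\<close>
  define p where "p X = ?D #>\<^bsub>ext\<^esub> X" for X
  have p: "p \<in> hom ext ?Q"
    unfolding p_def by (rule D.r_coset_hom_Mod)
  interpret p: group_hom ext ?Q p
    using p by unfold_locales
  \<comment> \<open>The 1-cell \<open>[x]\<close> goes to the class of the lift
    \<open>(\<one>, x)\<close>; as the target is abelian, this extends to all 1-chains.\<close>
  let ?j = "\<lambda>gs. p (\<one>\<^bsub>K\<^esub>, hd gs)"
  have "?j ` bar_cells 1 G \<subseteq> carrier ?Q"
    by (auto simp: bar_cells_def length_Suc_conv simp del: ext_simps intro!: p.hom_closed) auto
  then obtain k where k: "k \<in> hom (bar_chains 1 G) ?Q"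
    and k_of: "\<And>gs. gs \<in> bar_cells 1 G \<Longrightarrow> k (frag_of gs) = ?j gs"
    unfolding bar_chains_def by (rule Q.free_Abelian_group_universal) blast
  interpret k: group_hom "bar_chains 1 G" ?Q k
    using k comm_group_bar_chains[of 1 G] Q.is_group
    by (simp only: group_hom_def group_hom_axioms_def comm_group.axioms simp_thms)
  have one_eq: "p (\<one>\<^bsub>K\<^esub>, \<one>\<^bsub>G\<^esub>) = \<one>\<^bsub>?Q\<^esub>"
    using p.hom_one by simp
  \<comment> \<open>For \<open>x = \<one>\<close> both sides are trivial: the cell is read as 0, and
    \<open>(\<one>, \<one>)\<close> is the identity of the extension.\<close>
  have k_cell: "k (bar_cell G [x]) = p (\<one>\<^bsub>K\<^esub>, x)" if "x \<in> carrier G" for x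
    using that k_of[of "[x]"] k.hom_one one_eq by (auto simp: bar_cell_simps bar_cells_def)
  have cell_1: "bar_cell G [x] \<in> carrier (bar_chains 1 G)" if "x \<in> carrier G" for x
    using that by (intro bar_cell_chain) auto
  have boundary_1: "bar_boundary G c \<in> carrier (bar_chains 1 G)" if "c \<in> carrier (bar_chains 2 G)" for c
    using that bar_boundary_chain[of c 1] by (simp only: Suc_1)
  have hom1: "(\<lambda>c. k (bar_boundary G c)) \<in> hom (bar_chains 2 G) ?Q"
  proof (rule homI)
    fix c c' assume c: "c \<in> carrier (bar_chains 2 G)" "c' \<in> carrier (bar_chains 2 G)"
    show "k (bar_boundary G c) \<in> carrier ?Q"
      by (intro k.hom_closed boundary_1 c)
    show "k (bar_boundary G (c \<otimes>\<^bsub>bar_chains 2 G\<^esub> c')) =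
        k (bar_boundary G c) \<otimes>\<^bsub>?Q\<^esub> k (bar_boundary G c')"
      using k.hom_mult[OF boundary_1 boundary_1, OF c]
      by (simp only: bar_chains_simps(2) bar_boundary_add)
  qed
  have h_closed: "h c \<in> carrier K" if "c \<in> carrier (bar_chains 2 G)" for c
    using h that by (rule hom_in_carrier)
  have hom2: "(\<lambda>c. p (h c, \<one>\<^bsub>G\<^esub>)) \<in> hom (bar_chains 2 G) ?Q"
  proof (rule homI)
    fix c c' assume c: "c \<in> carrier (bar_chains 2 G)" "c' \<in> carrier (bar_chains 2 G)"
    show "p (h c, \<one>\<^bsub>G\<^esub>) \<in> carrier ?Q"
      using h_closed[OF c(1)] by (intro p.hom_closed) simp
    have "(h (c \<otimes>\<^bsub>bar_chains 2 G\<^esub> c'), \<one>\<^bsub>G\<^esub>) = (h c, \<one>\<^bsub>G\<^esub>) \<otimes>\<^bsub>ext\<^esub> (h c', \<one>\<^bsub>G\<^esub>)"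
      using h_closed[OF c(1)] h_closed[OF c(2)] hom_mult[OF h c] by simp
    then show "p (h (c \<otimes>\<^bsub>bar_chains 2 G\<^esub> c'), \<one>\<^bsub>G\<^esub>) = p (h c, \<one>\<^bsub>G\<^esub>) \<otimes>\<^bsub>?Q\<^esub> p (h c', \<one>\<^bsub>G\<^esub>)"
      using h_closed[OF c(1)] h_closed[OF c(2)] by (simp add: p.hom_mult del: ext_simps(2) mult_FactGroup)
  qed
  have "p (h c, \<one>\<^bsub>G\<^esub>) = k (bar_boundary G c)"
  proof (rule hom_free_Abelian_group_eq[OF Q.is_group hom2[unfolded bar_chains_def] hom1[unfolded bar_chains_def] _ c(1)[unfolded bar_chains_def]])
    fix gs assume "gs \<in> bar_cells 2 G"
    then obtain x y where gs: "gs = [x, y]" "x \<noteq> \<one>\<^bsub>G\<^esub>" "y \<noteq> \<one>\<^bsub>G\<^esub>"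
      and xy: "x \<in> carrier G" "y \<in> carrier G"
      unfolding bar_cells_2 by auto
    then have gs_cell: "frag_of gs = bar_cell G [x, y]"
      by (simp add: bar_cell_simps)
    \<comment> \<open>Both sides are multiplied by the class of \<open>(\<one>, x y)\<close>, which
      is cancelled at the end; this avoids inverses in the extension.\<close>
    have "p (h (frag_of gs), \<one>\<^bsub>G\<^esub>) \<otimes>\<^bsub>?Q\<^esub> p (\<one>\<^bsub>K\<^esub>, x \<otimes>\<^bsub>G\<^esub> y) = p ((f x y, \<one>\<^bsub>G\<^esub>) \<otimes>\<^bsub>ext\<^esub> (\<one>\<^bsub>K\<^esub>, x \<otimes>\<^bsub>G\<^esub> y))"
      using xy by (simp add: gs_cell f p.hom_mult del: ext_simps(2) mult_FactGroup)
    also have "\<dots> = p ((\<one>\<^bsub>K\<^esub>, x) \<otimes>\<^bsub>ext\<^esub> (\<one>\<^bsub>K\<^esub>, y))"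
      using xy by simp
    also have "\<dots> = k (bar_cell G [x]) \<otimes>\<^bsub>?Q\<^esub> k (bar_cell G [y])"
      using xy by (simp add: k_cell p.hom_mult del: ext_simps(2) mult_FactGroup)
    also have "\<dots> = k (bar_cell G [x] + bar_cell G [y])"
      using k.hom_mult[OF cell_1 cell_1, OF xy] by simp
    also have "bar_cell G [x] + bar_cell G [y] = bar_boundary G (frag_of gs) + bar_cell G [x \<otimes>\<^bsub>G\<^esub> y]"
      using xy by (simp add: gs_cell bar_boundary_cell_2)
    also have "k \<dots> = k (bar_boundary G (frag_of gs)) \<otimes>\<^bsub>?Q\<^esub> p (\<one>\<^bsub>K\<^esub>, x \<otimes>\<^bsub>G\<^esub> y)"
      using k.hom_mult[OF boundary_1 cell_1, of "frag_of gs" "x \<otimes>\<^bsub>G\<^esub> y"] xy \<open>gs \<in> bar_cells 2 G\<close>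
      by (simp add: k_cell)
    finally show "p (h (frag_of gs), \<one>\<^bsub>G\<^esub>) = k (bar_boundary G (frag_of gs))"
      using hom_in_carrier[OF hom1, of "frag_of gs"] hom_in_carrier[OF hom2, of "frag_of gs"]
        xy \<open>gs \<in> bar_cells 2 G\<close> p.hom_closed[of "(\<one>\<^bsub>K\<^esub>, x \<otimes>\<^bsub>G\<^esub> y)"]
      by (subst (asm) Q.right_cancel) simp_all
  qed
  then have "p (h c, \<one>\<^bsub>G\<^esub>) = \<one>\<^bsub>?Q\<^esub>"
    using c k.hom_one by simp
  then show ?thesis
    unfolding p_def using h_closed[OF c(1)] D.subset
    by (intro E.coset_join1[OF _ _ D.subgroup_axioms]) simp_all
qed

section \<open>The Schur multiplier and the classes from abelian subgroups\<close>

context group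
begin

lemma bar_cycle_group_simps [simp]:
  "c \<in> carrier (bar_cycle_group n G) \<longleftrightarrow> c \<in> carrier (bar_chains n G) \<and> bar_boundary G c = 0"
  "c \<otimes>\<^bsub>bar_cycle_group n G\<^esub> c' = c + c'"
  "\<one>\<^bsub>bar_cycle_group n G\<^esub> = 0"
  by (simp_all add: bar_cycle_group_def)

lemma subgroup_bar_cycles: "subgroup (carrier (bar_cycle_group n G)) (bar_chains n G)"
proof -
  interpret C: comm_group "bar_chains n G" by (rule comm_group_bar_chains)
  show ?thesis
  proof (rule C.subgroupI)
    show "carrier (bar_cycle_group n G) \<noteq> {}"
      by (metis C.one_closed bar_boundary_zero bar_chains_simps(3) bar_cycle_group_simps(1) empty_iff)
    show "inv\<^bsub>bar_chains n G\<^esub> c \<in> carrier (bar_cycle_group n G)"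
      if "c \<in> carrier (bar_cycle_group n G)" for c
      using that C.inv_closed[of c] by (simp add: bar_boundary_minus)
    show "c \<otimes>\<^bsub>bar_chains n G\<^esub> c' \<in> carrier (bar_cycle_group n G)"
      if "c \<in> carrier (bar_cycle_group n G)" "c' \<in> carrier (bar_cycle_group n G)" for c c'
      using that C.m_closed[of c c'] by (simp add: bar_boundary_add)
  qed auto
qed

lemma comm_group_bar_cycle_group: "comm_group (bar_cycle_group n G)"
proof (rule group.group_comm_groupI)
  show "group (bar_cycle_group n G)"
    using subgroup.subgroup_is_group[OF subgroup_bar_cycles comm_group.axioms(2)[OF comm_group_bar_chains], of n]
    by (simp add: bar_cycle_group_def)
qed (simp add: add.commute)

lemma bar_boundaries_2: "bar_boundaries 2 G = bar_boundary G ` carrier (bar_chains 3 G)"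
  by (simp add: bar_boundaries_def)

lemma inv_bar_cycle_group [simp]:
  "c \<in> carrier (bar_cycle_group n G) \<Longrightarrow> inv\<^bsub>bar_cycle_group n G\<^esub> c = - c"
  by (rule group.inv_equality[OF comm_group.axioms(2)[OF comm_group_bar_cycle_group]])
    (auto simp: bar_boundary_minus keys_minus)

lemma normal_bar_boundaries: "bar_boundaries 2 G \<lhd> bar_cycle_group 2 G"
proof -
  interpret Z: comm_group "bar_cycle_group 2 G" by (rule comm_group_bar_cycle_group)
  interpret C3: comm_group "bar_chains 3 G" by (rule comm_group_bar_chains)
  have incl: "bar_boundary G c \<in> carrier (bar_cycle_group 2 G)" if "c \<in> carrier (bar_chains 3 G)" for c
    using that bar_boundary_boundary_3[OF that] bar_boundary_chain[of c 2] by simp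
  have "subgroup (bar_boundaries 2 G) (bar_cycle_group 2 G)"
    unfolding bar_boundaries_2
  proof (rule Z.subgroupI)
    show "bar_boundary G ` carrier (bar_chains 3 G) \<noteq> {}"
      using C3.one_closed by blast
  next
    fix b assume "b \<in> bar_boundary G ` carrier (bar_chains 3 G)"
    then obtain c where c: "b = bar_boundary G c" "c \<in> carrier (bar_chains 3 G)" by blast
    then have "inv\<^bsub>bar_cycle_group 2 G\<^esub> b = bar_boundary G (inv\<^bsub>bar_chains 3 G\<^esub> c)"
      using incl by (simp add: bar_boundary_minus)
    then show "inv\<^bsub>bar_cycle_group 2 G\<^esub> b \<in> bar_boundary G ` carrier (bar_chains 3 G)"
      using C3.inv_closed c(2) by blast
  next
    fix b b' assume "b \<in> bar_boundary G ` carrier (bar_chains 3 G)"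
      and "b' \<in> bar_boundary G ` carrier (bar_chains 3 G)"
    then obtain c c' where c: "b = bar_boundary G c" "b' = bar_boundary G c'"
      "c \<in> carrier (bar_chains 3 G)" "c' \<in> carrier (bar_chains 3 G)" by blast
    then have "b \<otimes>\<^bsub>bar_cycle_group 2 G\<^esub> b' = bar_boundary G (c \<otimes>\<^bsub>bar_chains 3 G\<^esub> c')"
      by (simp add: bar_boundary_add)
    then show "b \<otimes>\<^bsub>bar_cycle_group 2 G\<^esub> b' \<in> bar_boundary G ` carrier (bar_chains 3 G)"
      using C3.m_closed c(3,4) by blast
  qed (use incl in blast)
  then show ?thesis by (rule Z.subgroup_imp_normal)
qed

lemma comm_group_schur_multiplier: "comm_group (schur_multiplier G)"
  unfolding schur_multiplier_def grp_homology_def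
  using comm_group.abelian_FactGroup[OF comm_group_bar_cycle_group]
    normal_bar_boundaries normal_imp_subgroup by blast

abbreviation homology_class :: "('a list \<Rightarrow>\<^sub>0 int) \<Rightarrow> ('a list \<Rightarrow>\<^sub>0 int) set" where
  "homology_class c \<equiv> bar_boundaries 2 G #>\<^bsub>bar_cycle_group 2 G\<^esub> c"

lemma homology_class_hom: "homology_class \<in> hom (bar_cycle_group 2 G) (schur_multiplier G)"
  unfolding schur_multiplier_def grp_homology_def
  using normal.r_coset_hom_Mod[OF normal_bar_boundaries] .

lemma carrier_schur_multiplier:
  "carrier (schur_multiplier G) = homology_class ` carrier (bar_cycle_group 2 G)"
  by (simp only: schur_multiplier_def grp_homology_def carrier_FactGroup)

section \<open>Classes coming from subgroups\<close>

lemma bar_chains_subgroup_mono: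
  "B \<subseteq> carrier G \<Longrightarrow> carrier (bar_chains n (G\<lparr>carrier := B\<rparr>)) \<subseteq> carrier (bar_chains n G)"
  by (fastforce simp: bar_cells_def)

text \<open>Chains of a subgroup are chains of \<open>G\<close>, with the same boundary. On them the
  chain map of the inclusion is the identity, and boundaries stay boundaries, so every
  representative yields the same coset.\<close>

lemma grp_homology_induced_inclusion:
  assumes B: "subgroup B G" and c: "c \<in> carrier (bar_cycle_group 2 (G\<lparr>carrier := B\<rparr>))"
  shows "grp_homology_induced 2 (G\<lparr>carrier := B\<rparr>) G (\<lambda>x. x)
      (bar_boundaries 2 (G\<lparr>carrier := B\<rparr>) #>\<^bsub>bar_cycle_group 2 (G\<lparr>carrier := B\<rparr>)\<^esub> c) = homology_class c"
    and "c \<in> carrier (bar_cycle_group 2 G)"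
proof -
  let ?H = "G\<lparr>carrier := B\<rparr>"
  interpret H: group ?H
    by (rule subgroup.subgroup_is_group[OF B is_group])
  interpret N: normal "bar_boundaries 2 G" "bar_cycle_group 2 G"
    by (rule normal_bar_boundaries)
  interpret NH: normal "bar_boundaries 2 ?H" "bar_cycle_group 2 ?H"
    by (rule H.normal_bar_boundaries)
  have chains: "carrier (bar_chains n ?H) \<subseteq> carrier (bar_chains n G)" for n
    using bar_chains_subgroup_mono subgroup.subset[OF B] by blast
  have cycles: "c' \<in> carrier (bar_cycle_group 2 G)" if "c' \<in> carrier (bar_cycle_group 2 ?H)" for c'
    using that chains by (auto simp: H.bar_cycle_group_simps simp del: bar_chains_simps)
  show cG: "c \<in> carrier (bar_cycle_group 2 G)"
    using c by (rule cycles)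
  have image: "homology_class (frag_extend (\<lambda>gs. bar_cell G (map (\<lambda>x. x) gs)) c') = homology_class c"
    if c': "c' \<in> bar_boundaries 2 ?H #>\<^bsub>bar_cycle_group 2 ?H\<^esub> c" for c'
  proof -
    have "c' \<in> carrier (bar_cycle_group 2 G)"
      using c' c NH.r_coset_subset_G[OF NH.subset] by (intro cycles) blast
    \<comment> \<open>The cells of \<open>c'\<close> have no entry \<open>\<one>\<close>, so
      \<open>bar_cell\<close> leaves each of them unchanged.\<close>
    then have "frag_extend (\<lambda>gs. bar_cell G (map (\<lambda>x. x) gs)) c' = frag_extend frag_of c'"
      by (intro frag_extend_eq) (auto simp: bar_cell_def bar_cells_def)
    then have eq: "frag_extend (\<lambda>gs. bar_cell G (map (\<lambda>x. x) gs)) c' = c'"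
      by (simp flip: frag_expansion)
    obtain b where "b \<in> bar_boundaries 2 ?H" "c' = b + c"
      using c' by (auto simp: r_coset_def H.bar_cycle_group_simps)
    moreover have "bar_boundaries 2 ?H \<subseteq> bar_boundaries 2 G"
      using chains unfolding bar_boundaries_def by auto
    ultimately have "c' \<in> homology_class c"
      by (auto simp: r_coset_def)
    then show ?thesis
      unfolding eq using N.repr_independence[OF _ cG N.subgroup_axioms] by simp
  qed
  \<comment> \<open>The image is a singleton, nonempty since \<open>c\<close> lies in its own coset;
    this evaluates \<open>the_elem\<close>.\<close>
  have "(\<lambda>c'. homology_class (frag_extend (\<lambda>gs. bar_cell G (map (\<lambda>x. x) gs)) c')) `
      (bar_boundaries 2 ?H #>\<^bsub>bar_cycle_group 2 ?H\<^esub> c) = {homology_class c}"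
    using image NH.rcos_self[OF c NH.subgroup_axioms] by blast
  then show "grp_homology_induced 2 ?H G (\<lambda>x. x)
      (bar_boundaries 2 ?H #>\<^bsub>bar_cycle_group 2 ?H\<^esub> c) = homology_class c"
    unfolding grp_homology_induced_def by simp
qed

lemma carrier_grp_homology:
  "carrier (grp_homology n G) = (\<lambda>c. bar_boundaries n G #>\<^bsub>bar_cycle_group n G\<^esub> c) ` carrier (bar_cycle_group n G)"
  by (simp only: grp_homology_def carrier_FactGroup)

lemma schur_multiplier_ab_eq:
  "schur_multiplier_ab G = generate (schur_multiplier G)
     (homology_class ` (\<Union>B \<in> {B. subgroup B G \<and> comm_group (G\<lparr>carrier := B\<rparr>)}.
        carrier (bar_cycle_group 2 (G\<lparr>carrier := B\<rparr>))))"
proof -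
  have "grp_homology_induced 2 (G\<lparr>carrier := B\<rparr>) G (\<lambda>x. x) ` carrier (grp_homology 2 (G\<lparr>carrier := B\<rparr>))
      = homology_class ` carrier (bar_cycle_group 2 (G\<lparr>carrier := B\<rparr>))"
    if "subgroup B G" for B
  proof -
    interpret H: group "G\<lparr>carrier := B\<rparr>"
      by (rule subgroup.subgroup_is_group[OF that is_group])
    show ?thesis
      unfolding H.carrier_grp_homology image_image
      by (rule image_cong[OF refl]) (rule grp_homology_induced_inclusion(1)[OF that])
  qed
  then have "(\<Union>B \<in> {B. subgroup B G \<and> comm_group (G\<lparr>carrier := B\<rparr>)}.
      grp_homology_induced 2 (G\<lparr>carrier := B\<rparr>) G (\<lambda>x. x) ` carrier (grp_homology 2 (G\<lparr>carrier := B\<rparr>)))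
      = homology_class ` (\<Union>B \<in> {B. subgroup B G \<and> comm_group (G\<lparr>carrier := B\<rparr>)}.
        carrier (bar_cycle_group 2 (G\<lparr>carrier := B\<rparr>)))"
    unfolding image_UN by (intro SUP_cong) auto
  then show ?thesis
    unfolding schur_multiplier_ab_def by (rule arg_cong)
qed

lemma subgroup_schur_multiplier_ab: "subgroup (schur_multiplier_ab G) (schur_multiplier G)"
  unfolding schur_multiplier_ab_eq
proof (rule group.generate_is_subgroup[OF comm_group.axioms(2)[OF comm_group_schur_multiplier]])
  show "homology_class ` (\<Union>B \<in> {B. subgroup B G \<and> comm_group (G\<lparr>carrier := B\<rparr>)}.
      carrier (bar_cycle_group 2 (G\<lparr>carrier := B\<rparr>))) \<subseteq> carrier (schur_multiplier G)"
    unfolding carrier_schur_multiplier using grp_homology_induced_inclusion(2) by blast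
qed

text \<open>The centralizer argument of \<open>commutator_generate_left\<close> for the trivial
  normal subgroup, used once for each argument.\<close>

lemma comm_group_generate:
  assumes X: "X \<subseteq> carrier G" and comm: "\<And>x y. \<lbrakk>x \<in> X; y \<in> X\<rbrakk> \<Longrightarrow> x \<otimes> y = y \<otimes> x"
  shows "comm_group (G\<lparr>carrier := generate G X\<rparr>)"
proof -
  have triv: "{\<one>} \<lhd> G"
    using one_is_normal .
  have gen: "x \<in> carrier G" if "x \<in> generate G X" for x
    using generate_in_carrier[OF X that] .
  have XC: "x \<in> carrier G" if "x \<in> X" for x
    using that X by blast
  have 1: "commutator x y = \<one>" if "x \<in> generate G X" "y \<in> X" for x y
    using commutator_generate_left[OF triv X XC _ that(1)] that comm by (simp add: commutator_eq_one_iff XC)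
  have "commutator x y = \<one>" if "x \<in> generate G X" "y \<in> generate G X" for x y
    using commutator_generate_left[OF triv X gen _ that(1)] that 1 by (simp add: commutator_eq_one_iff XC gen)
  then have "x \<otimes> y = y \<otimes> x" if "x \<in> generate G X" "y \<in> generate G X" for x y
    using that gen by (simp add: commutator_eq_one_iff)
  then show ?thesis
    using generate_is_subgroup[OF X] subgroup.subgroup_is_group[OF _ is_group]
    by (intro group.group_comm_groupI) auto
qed

text \<open>The chain is already a cycle of the abelian subgroup generated by \<open>x\<close> and
  \<open>y\<close>; the two boundaries agree because
  \<open>x \<otimes> y = y \<otimes> x\<close>.\<close>

lemma commuting_cycle:
  assumes xy: "x \<in> carrier G" "y \<in> carrier G" "x \<otimes> y = y \<otimes> x"
  defines "c \<equiv> bar_cell G [x, y] - bar_cell G [y, x]"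
  shows "c \<in> carrier (bar_cycle_group 2 G)" "homology_class c \<in> schur_multiplier_ab G"
proof -
  let ?B = "generate G {x, y}"
  let ?H = "G\<lparr>carrier := ?B\<rparr>"
  have B: "subgroup ?B G"
    using xy by (intro generate_is_subgroup) auto
  have comm: "comm_group ?H"
    using xy by (intro comm_group_generate) auto
  then interpret H: group ?H
    by (simp add: comm_group.axioms)
  interpret C: comm_group "bar_chains 2 ?H"
    by (rule comm_group_bar_chains)
  have xyB: "x \<in> ?B" "y \<in> ?B"
    by (auto intro: generate.incl)
  have cell: "bar_cell G gs = bar_cell ?H gs" for gs
    by (simp add: bar_cell_def)
  have "bar_cell ?H [a, b] \<in> carrier (bar_chains 2 ?H)" if "a \<in> ?B" "b \<in> ?B" for a b
    using that by (intro bar_cell_chain) auto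
  then have "bar_cell ?H [x, y] \<otimes>\<^bsub>bar_chains 2 ?H\<^esub> inv\<^bsub>bar_chains 2 ?H\<^esub> bar_cell ?H [y, x] \<in> carrier (bar_chains 2 ?H)"
    using xyB by (intro C.m_closed C.inv_closed) auto
  then have "c \<in> carrier (bar_chains 2 ?H)"
    unfolding c_def cell
    using \<open>\<And>b a. \<lbrakk>a \<in> ?B; b \<in> ?B\<rbrakk> \<Longrightarrow> bar_cell ?H [a, b] \<in> carrier (bar_chains 2 ?H)\<close>[OF xyB(2,1)]
    by (simp only: inv_bar_chains bar_chains_simps(2) diff_conv_add_uminus)
  moreover have "bar_boundary G c = 0"
    using xy by (simp add: c_def bar_boundary_diff bar_boundary_cell_2)
  ultimately have "c \<in> carrier (bar_cycle_group 2 ?H)"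
    by (simp add: H.bar_cycle_group_simps)
  then have c: "c \<in> (\<Union>B \<in> {B. subgroup B G \<and> comm_group (G\<lparr>carrier := B\<rparr>)}.
      carrier (bar_cycle_group 2 (G\<lparr>carrier := B\<rparr>)))"
    using B comm by blast
  then show "c \<in> carrier (bar_cycle_group 2 G)"
    using grp_homology_induced_inclusion(2) by blast
  show "homology_class c \<in> schur_multiplier_ab G"
    unfolding schur_multiplier_ab_eq using c by (intro generate.incl imageI)
qed

end

section \<open>Vanishing of the Bogomolov multiplier\<close>

lemma (in abelian_by_bicyclic) schur_multiplier_ab_full:
  assumes z: "z \<in> carrier (bar_cycle_group 2 G)"
  shows "homology_class z \<in> schur_multiplier_ab G"
proof -
  let ?C = "bar_chains 2 G" and ?Z = "bar_cycle_group 2 G" and ?M = "schur_multiplier G"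
  let ?U = "schur_multiplier_ab G"
  interpret C: comm_group ?C by (rule comm_group_bar_chains)
  interpret Z: comm_group ?Z by (rule comm_group_bar_cycle_group)
  interpret M: comm_group ?M by (rule comm_group_schur_multiplier)
  interpret U: subgroup ?U ?M by (rule subgroup_schur_multiplier_ab)
  interpret cl: group_hom ?Z ?M homology_class
    using homology_class_hom by unfold_locales
  \<comment> \<open>\<open>N\<close> consists of cycles, but the quotient is formed in all 2-chains:
    single cells \<open>[x|y]\<close> are in general not cycles, and they are to give the values of
    the cocycle.\<close>
  define N where "N = {c \<in> carrier ?Z. homology_class c \<in> ?U}"
  have "subgroup N ?C"
  proof (rule C.subgroupI)
    show "N \<subseteq> carrier ?C" by (auto simp: N_def)
    have "\<one>\<^bsub>?Z\<^esub> \<in> N"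
      unfolding N_def using cl.hom_one subgroup.one_closed[OF U.subgroup_axioms] Z.one_closed by auto
    then show "N \<noteq> {}" by blast
  next
    fix c assume c: "c \<in> N"
    then have "inv\<^bsub>?Z\<^esub> c \<in> N"
      unfolding N_def using Z.inv_closed cl.hom_inv U.m_inv_closed by (metis (lifting) mem_Collect_eq)
    then show "inv\<^bsub>?C\<^esub> c \<in> N"
      using c by (simp add: N_def)
  next
    fix c c' assume c: "c \<in> N" "c' \<in> N"
    then have "c \<otimes>\<^bsub>?Z\<^esub> c' \<in> N"
      unfolding N_def using Z.m_closed cl.hom_mult U.m_closed by (metis (lifting) mem_Collect_eq)
    then show "c \<otimes>\<^bsub>?C\<^esub> c' \<in> N" by simp
  qed
  then interpret N: normal N ?C by (rule C.subgroup_imp_normal)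
  let ?K = "?C Mod N"
  interpret K: comm_group ?K by (rule C.abelian_FactGroup[OF N.subgroup_axioms])
  define h where "h c = N #>\<^bsub>?C\<^esub> c" for c
  have h: "h \<in> hom ?C ?K"
    unfolding h_def by (rule N.r_coset_hom_Mod)
  interpret h: group_hom ?C ?K h
    using h by unfold_locales
  have NC: "c \<in> carrier ?C" if "c \<in> N" for c
    using that N.subset by blast
  have h_N: "h c = \<one>\<^bsub>?K\<^esub>" if "c \<in> N" for c
    unfolding h_def using that by (simp add: C.coset_join2[OF NC N.subgroup_axioms])
  have h_add: "h (c + c') = h c \<otimes>\<^bsub>?K\<^esub> h c'" if "c \<in> carrier ?C" "c' \<in> carrier ?C" for c c'
    using h.hom_mult[OF that] by simp
  have h_add_N: "h (c + c') = h c'" if "c \<in> N" "c' \<in> carrier ?C" for c c'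
    using h_add[OF NC that(2)] that h_N[of c] h.hom_closed[OF that(2)] by (simp del: mult_FactGroup one_FactGroup)
  \<comment> \<open>Boundaries have trivial class, so they vanish modulo \<open>N\<close>; this is
    the source of the cocycle identity.\<close>
  have boundary_N: "bar_boundary G c \<in> N" if "c \<in> carrier (bar_chains 3 G)" for c
  proof -
    interpret Bd: normal "bar_boundaries 2 G" ?Z by (rule normal_bar_boundaries)
    have b: "bar_boundary G c \<in> bar_boundaries 2 G"
      unfolding bar_boundaries_2 using that by blast
    then have "homology_class (bar_boundary G c) = bar_boundaries 2 G"
      using Z.coset_join2[OF _ Bd.subgroup_axioms] Bd.subset by blast
    also have "\<dots> = \<one>\<^bsub>?M\<^esub>"
      by (simp add: schur_multiplier_def grp_homology_def)
    finally have "homology_class (bar_boundary G c) \<in> ?U"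
      using subgroup.one_closed[OF U.subgroup_axioms] by simp
    moreover have "bar_boundary G c \<in> carrier ?Z"
      using b Bd.subset by blast
    ultimately show ?thesis
      unfolding N_def by blast
  qed
  define f where "f x y = h (bar_cell G [x, y])" for x y
  have cell: "bar_cell G [x, y] \<in> carrier ?C" if "x \<in> carrier G" "y \<in> carrier G" for x y
    using that by (intro bar_cell_chain) auto
  have f_closed: "f x y \<in> carrier ?K" if "x \<in> carrier G" "y \<in> carrier G" for x y
    unfolding f_def by (intro h.hom_closed cell that)
  have f_one: "f x \<one> = \<one>\<^bsub>?K\<^esub>" "f \<one> x = \<one>\<^bsub>?K\<^esub>" for x
    using h.hom_one by (simp_all add: f_def bar_cell_simps del: one_FactGroup)
  interpret commuting_two_cocycle ?K G f
  proof
    fix x y z assume xyz: "x \<in> carrier G" "y \<in> carrier G" "z \<in> carrier G"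
    show "f x y \<otimes>\<^bsub>?K\<^esub> f (x \<otimes> y) z = f y z \<otimes>\<^bsub>?K\<^esub> f x (y \<otimes> z)"
    \<comment> \<open>Only triples without the identity are 3-cells; for the others the identity
      follows from normalization.\<close>
    proof (cases "\<one> \<in> {x, y, z}")
      case True
      then show ?thesis
        using xyz f_one f_closed by (auto simp del: mult_FactGroup one_FactGroup)
    next
      case False
      then have "bar_boundary G (frag_of [x, y, z]) \<in> N"
        using xyz by (intro boundary_N) (auto simp: bar_cells_3)
      moreover have "bar_cell G [x, y] + bar_cell G [x \<otimes> y, z] \<in> carrier ?C"
        using C.m_closed[OF cell cell, of x y "x \<otimes> y" z] xyz by simp
      \<comment> \<open>Adding the boundary of \<open>[x|y|z]\<close> turns
        \<open>[x|y] + [xy|z]\<close> into \<open>[y|z] + [x|yz]\<close>.\<close>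
      ultimately have "h (bar_boundary G (frag_of [x, y, z]) + (bar_cell G [x, y] + bar_cell G [x \<otimes> y, z]))
          = h (bar_cell G [x, y] + bar_cell G [x \<otimes> y, z])"
        by (rule h_add_N)
      then have "h (bar_cell G [y, z] + bar_cell G [x, y \<otimes> z]) = h (bar_cell G [x, y] + bar_cell G [x \<otimes> y, z])"
        by (simp add: bar_boundary_cell_3 algebra_simps)
      then show ?thesis
        using xyz cell by (simp only: h_add f_def m_closed)
    qed
  next
    fix x y assume xy: "x \<in> carrier G" "y \<in> carrier G" "x \<otimes> y = y \<otimes> x"
    then have "bar_cell G [x, y] - bar_cell G [y, x] \<in> N"
      unfolding N_def using commuting_cycle by blast
    from h_add_N[OF this cell[OF xy(2,1)]] show "f x y = f y x"
      by (simp add: f_def)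
  qed (simp_all add: f_closed f_one del: mult_FactGroup one_FactGroup)
  \<comment> \<open>The cycle \<open>z\<close> thus gives an element of the derived subgroup in the
    kernel \<open>K\<close>; its vanishing there means that \<open>z\<close> lies in
    \<open>N\<close>.\<close>
  have "(h z, \<one>) \<in> derived ext (carrier ext)"
    using z by (intro cycle_in_derived h) (simp_all add: f_def)
  then have "(h z, \<one>) = \<one>\<^bsub>ext\<^esub>"
    using kernel_inter_derived[OF abelian_by_bicyclic_axioms] by simp
  then have "h z = N" by simp
  then have "z \<in> N"
    unfolding h_def using z C.coset_join1[OF _ _ N.subgroup_axioms] by simp
  then show ?thesis by (simp add: N_def)
qed

lemma (in abelian_by_bicyclic) trivial_bogomolov_multiplier:
  "trivial_group (bogomolov_multiplier G)"
proof -
  let ?M = "schur_multiplier G" and ?U = "schur_multiplier_ab G"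
  interpret M: comm_group ?M by (rule comm_group_schur_multiplier)
  have sub: "subgroup ?U ?M" by (rule subgroup_schur_multiplier_ab)
  have "carrier ?M \<subseteq> ?U"
    unfolding carrier_schur_multiplier using schur_multiplier_ab_full by blast
  then have "?U #>\<^bsub>?M\<^esub> x = ?U" if "x \<in> carrier ?M" for x
    using M.coset_join2[OF that sub] that by blast
  then have "carrier (?M Mod ?U) = {?U}"
    unfolding carrier_FactGroup using M.one_closed by blast
  moreover have "group (?M Mod ?U)"
    using M.abelian_FactGroup[OF sub] by (simp add: comm_group.axioms)
  ultimately show ?thesis
    by (simp add: trivial_group_def bogomolov_multiplier_def)
qed

section \<open>Semidirect products with bicyclic groups\<close>

lemma semidirect_product_simps [simp]:
  "carrier (semidirect_product A Q \<phi>) = carrier A \<times> carrier Q"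
  "(a, q) \<otimes>\<^bsub>semidirect_product A Q \<phi>\<^esub> (a', q') = (a \<otimes>\<^bsub>A\<^esub> \<phi> q a', q \<otimes>\<^bsub>Q\<^esub> q')"
  "\<one>\<^bsub>semidirect_product A Q \<phi>\<^esub> = (\<one>\<^bsub>A\<^esub>, \<one>\<^bsub>Q\<^esub>)"
  by (simp_all add: semidirect_product_def)

text \<open>Composition and identity in \<open>AutoGroup A\<close> are functions restricted to the
  carrier, hence the pointwise equations there.\<close>

lemma hom_AutoGroup:
  assumes "group A" "group Q" and \<phi>: "\<phi> \<in> hom Q (AutoGroup A)"
  shows "q \<in> carrier Q \<Longrightarrow> \<phi> q \<in> hom A A"
    and "\<lbrakk>q \<in> carrier Q; r \<in> carrier Q; a \<in> carrier A\<rbrakk> \<Longrightarrow> \<phi> (q \<otimes>\<^bsub>Q\<^esub> r) a = \<phi> q (\<phi> r a)"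
    and "a \<in> carrier A \<Longrightarrow> \<phi> \<one>\<^bsub>Q\<^esub> a = a"
proof -
  have auto: "\<phi> q \<in> auto A" if "q \<in> carrier Q" for q
    using hom_in_carrier[OF \<phi> that] by (simp add: AutoGroup_def)
  then show "\<phi> q \<in> hom A A" if "q \<in> carrier Q"
    using that by (simp add: auto_def)
  show "\<phi> (q \<otimes>\<^bsub>Q\<^esub> r) a = \<phi> q (\<phi> r a)"
    if "q \<in> carrier Q" "r \<in> carrier Q" "a \<in> carrier A"
    using hom_mult[OF \<phi> that(1,2)] auto[OF that(1)] auto[OF that(2)] that(3)
    by (simp add: AutoGroup_def BijGroup_def auto_def compose_def)
  have "\<phi> \<one>\<^bsub>Q\<^esub> = \<one>\<^bsub>AutoGroup A\<^esub>"
    by (rule hom_one[OF \<phi> assms(2) group.AutoGroup[OF assms(1)]])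
  then show "\<phi> \<one>\<^bsub>Q\<^esub> a = a" if "a \<in> carrier A"
    using that by (simp add: AutoGroup_def BijGroup_def)
qed

text \<open>The copy of \<open>A\<close> is the kernel of the projection to the abelian group
  \<open>Q\<close>, and the lifts of \<open>s\<close> and \<open>t\<close> commute because they lie
  in the embedded copy of \<open>Q\<close>.\<close>

lemma abelian_by_bicyclic_semidirect_product:
  fixes A :: "('a, 'm) monoid_scheme" and Q :: "('b, 'n) monoid_scheme"
  assumes A: "comm_group A" and Q: "comm_group Q" and \<phi>: "\<phi> \<in> hom Q (AutoGroup A)"
    and st: "s \<in> carrier Q" "t \<in> carrier Q" and gen: "carrier Q = generate Q {s, t}"
  shows "abelian_by_bicyclic (carrier A \<times> {\<one>\<^bsub>Q\<^esub>}) (semidirect_product A Q \<phi>) (\<one>\<^bsub>A\<^esub>, s) (\<one>\<^bsub>A\<^esub>, t)"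
proof -
  let ?G = "semidirect_product A Q \<phi>" and ?B = "carrier A \<times> {\<one>\<^bsub>Q\<^esub>}"
  interpret A: comm_group A by (rule A)
  interpret Q: comm_group Q by (rule Q)
  note \<phi>_hom = hom_AutoGroup(1)[OF A.is_group Q.is_group \<phi>]
  note [simp] = hom_AutoGroup(2,3)[OF A.is_group Q.is_group \<phi>]
  have [simp]: "\<phi> q a \<in> carrier A" if "q \<in> carrier Q" "a \<in> carrier A" for q a
    using hom_in_carrier[OF \<phi>_hom] that .
  have [simp]: "\<phi> q (a \<otimes>\<^bsub>A\<^esub> b) = \<phi> q a \<otimes>\<^bsub>A\<^esub> \<phi> q b"
    if "q \<in> carrier Q" "a \<in> carrier A" "b \<in> carrier A" for q a b
    using hom_mult[OF \<phi>_hom] that .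
  have [simp]: "\<phi> q \<one>\<^bsub>A\<^esub> = \<one>\<^bsub>A\<^esub>" if "q \<in> carrier Q" for q
    using hom_one[OF \<phi>_hom[OF that] A.is_group A.is_group] .
  interpret G: group ?G
  proof (rule groupI)
    fix x y z assume "x \<in> carrier ?G" "y \<in> carrier ?G" "z \<in> carrier ?G"
    then show "x \<otimes>\<^bsub>?G\<^esub> y \<otimes>\<^bsub>?G\<^esub> z = x \<otimes>\<^bsub>?G\<^esub> (y \<otimes>\<^bsub>?G\<^esub> z)"
      by (auto simp: A.m_assoc Q.m_assoc)
  next
    fix x assume "x \<in> carrier ?G"
    then obtain a q where x: "x = (a, q)" "a \<in> carrier A" "q \<in> carrier Q" by auto
    let ?y = "(\<phi> (inv\<^bsub>Q\<^esub> q) (inv\<^bsub>A\<^esub> a), inv\<^bsub>Q\<^esub> q)"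
    have "\<phi> (inv\<^bsub>Q\<^esub> q) (inv\<^bsub>A\<^esub> a \<otimes>\<^bsub>A\<^esub> a) = \<phi> (inv\<^bsub>Q\<^esub> q) (inv\<^bsub>A\<^esub> a) \<otimes>\<^bsub>A\<^esub> \<phi> (inv\<^bsub>Q\<^esub> q) a"
      using x by (intro hom_mult[OF \<phi>_hom]) auto
    then have "?y \<otimes>\<^bsub>?G\<^esub> x = \<one>\<^bsub>?G\<^esub>"
      using x by simp
    then show "\<exists>y \<in> carrier ?G. y \<otimes>\<^bsub>?G\<^esub> x = \<one>\<^bsub>?G\<^esub>"
      using x by (intro bexI[of _ ?y]) auto
  qed auto
  interpret p: group_hom ?G Q snd
    by unfold_locales (auto simp: hom_def)
  have "kernel ?G Q snd = ?B"
    by (auto simp: kernel_def)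
  then have normal: "?B \<lhd> ?G"
    using p.normal_kernel by simp
  interpret i: group_hom Q ?G "\<lambda>q. (\<one>\<^bsub>A\<^esub>, q)"
    by unfold_locales (auto simp: hom_def)
  let ?X = "?B \<union> {(\<one>\<^bsub>A\<^esub>, s), (\<one>\<^bsub>A\<^esub>, t)}"
  have sub: "?X \<subseteq> carrier ?G" using st by auto
  interpret gen: subgroup "generate ?G ?X" ?G
    by (rule G.generate_is_subgroup[OF sub])
  have Q_gen: "(\<one>\<^bsub>A\<^esub>, q) \<in> generate ?G ?X" if "q \<in> carrier Q" for q
  proof -
    have "(\<one>\<^bsub>A\<^esub>, q) \<in> (\<lambda>q. (\<one>\<^bsub>A\<^esub>, q)) ` generate Q {s, t}"
      using that gen by blast
    also have "\<dots> = generate ?G {(\<one>\<^bsub>A\<^esub>, s), (\<one>\<^bsub>A\<^esub>, t)}"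
      using i.generate_img[of "{s, t}"] st by simp
    also have "\<dots> \<subseteq> generate ?G ?X"
      by (rule G.mono_generate) blast
    finally show ?thesis .
  qed
  \<comment> \<open>Here \<open>(a, q)\<close> is the product of \<open>(a, \<one>)\<close> and
    \<open>(\<one>, q)\<close>, since \<open>\<one>\<close> acts trivially.\<close>
  have "(a, q) \<in> generate ?G ?X" if "a \<in> carrier A" "q \<in> carrier Q" for a q
  proof -
    have "(a, \<one>\<^bsub>Q\<^esub>) \<in> generate ?G ?X"
      using that by (intro generate.incl) simp
    from gen.m_closed[OF this Q_gen[OF that(2)]] show ?thesis
      using that by simp
  qed
  then have gen_eq: "carrier ?G = generate ?G ?X"
    using gen.subset by auto
  show ?thesis
  proof (intro abelian_by_bicyclic.intro normal abelian_by_bicyclic_axioms.intro gen_eq)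
    show "x \<otimes>\<^bsub>?G\<^esub> y = y \<otimes>\<^bsub>?G\<^esub> x" if "x \<in> ?B" "y \<in> ?B" for x y
      using that by (auto simp: A.m_comm)
    show "G.commutator x y \<in> ?B" if "x \<in> carrier ?G" "y \<in> carrier ?G" for x y
    proof -
      have "snd (G.commutator x y) = Q.commutator (snd x) (snd y)"
        unfolding G.commutator_def Q.commutator_def
        using that by (simp only: p.hom_mult p.hom_inv G.m_closed G.inv_closed)
      also have "\<dots> = \<one>\<^bsub>Q\<^esub>"
        using that by (subst Q.commutator_eq_one_iff) (auto intro: Q.m_comm)
      finally show ?thesis
        using G.commutator_closed[OF that] by (simp add: mem_Times_iff)
    qed
    show "(\<one>\<^bsub>A\<^esub>, s) \<otimes>\<^bsub>?G\<^esub> (\<one>\<^bsub>A\<^esub>, t) = (\<one>\<^bsub>A\<^esub>, t) \<otimes>\<^bsub>?G\<^esub> (\<one>\<^bsub>A\<^esub>, s)"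
    proof -
      have "\<phi> s \<one>\<^bsub>A\<^esub> = \<one>\<^bsub>A\<^esub>" "\<phi> t \<one>\<^bsub>A\<^esub> = \<one>\<^bsub>A\<^esub>"
        using st by simp_all
      then show ?thesis
        by (simp only: semidirect_product_simps Q.m_comm[OF st(2,1)])
    qed
    show "(\<one>\<^bsub>A\<^esub>, s) \<in> carrier ?G" "(\<one>\<^bsub>A\<^esub>, t) \<in> carrier ?G"
      using st by simp_all
  qed
qed

section \<open>Generators of bicyclic groups\<close>

lemma (in group) cyclic_groupE:
  assumes "cyclic_group G"
  obtains x where "x \<in> carrier G" "carrier G = generate G {x}"
proof -
  obtain x where x: "x \<in> carrier G" "subgroup_generated G {x} = G"
    using assms by (auto simp: cyclic_group_def)
  then have "carrier G = generate G {x}"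
    using carrier_subgroup_generated[of G "{x}"] by (simp add: Int_absorb1)
  then show thesis using x(1) that by blast
qed

lemma bicyclic_groupE:
  fixes Q :: "('a, 'm) monoid_scheme"
  assumes "bicyclic_group Q"
  obtains s t where "comm_group Q" "s \<in> carrier Q" "t \<in> carrier Q" "carrier Q = generate Q {s, t}"
proof -
  interpret Q: group Q using assms by (simp add: bicyclic_group_def)
  consider "cyclic_group Q"
    | (prod) C D :: "'a monoid" where "group C" "cyclic_group C" "group D" "cyclic_group D" "Q \<cong> C \<times>\<times> D"
    using assms unfolding bicyclic_group_def by blast
  then show thesis
  proof cases
    case 1
    obtain x where "x \<in> carrier Q" "carrier Q = generate Q {x}"
      using 1 by (rule Q.cyclic_groupE)
    then show thesis
      \<comment> \<open>A cyclic group is given its generator twice.\<close>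
      using that[of x x] Q.cyclic_imp_abelian_group[OF 1] by simp
  next
    case prod
    let ?P = "C \<times>\<times> D"
    interpret C: comm_group C by (rule group.cyclic_imp_abelian_group) fact+
    interpret D: comm_group D by (rule group.cyclic_imp_abelian_group) fact+
    interpret P: group ?P by (rule DirProd_group) fact+
    have "?P \<cong> Q" using prod(5) by (rule Q.iso_sym)
    then obtain \<psi> where \<psi>: "\<psi> \<in> iso ?P Q" by (auto simp: is_iso_def)
    interpret \<psi>: group_hom ?P Q \<psi>
      using \<psi> by unfold_locales (simp add: iso_def)
    interpret i: group_hom C ?P "\<lambda>x. (x, \<one>\<^bsub>D\<^esub>)"
      by unfold_locales (auto simp: hom_def)
    interpret j: group_hom D ?P "\<lambda>y. (\<one>\<^bsub>C\<^esub>, y)"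
      by unfold_locales (auto simp: hom_def)
    obtain c where c: "c \<in> carrier C" "carrier C = generate C {c}"
      using prod(2) by (rule C.cyclic_groupE)
    obtain d where d: "d \<in> carrier D" "carrier D = generate D {d}"
      using prod(4) by (rule D.cyclic_groupE)
    \<comment> \<open>The generators of the two factors, embedded in the product; their images under
      \<open>\<psi>\<close> generate \<open>Q\<close>.\<close>
    let ?X = "{(c, \<one>\<^bsub>D\<^esub>), (\<one>\<^bsub>C\<^esub>, d)}"
    have X: "?X \<subseteq> carrier ?P" using c d by auto
    interpret gen: subgroup "generate ?P ?X" ?P
      by (rule P.generate_is_subgroup[OF X])
    have "(x, y) \<in> generate ?P ?X" if "x \<in> carrier C" "y \<in> carrier D" for x y
    proof -
      have "(x, \<one>\<^bsub>D\<^esub>) \<in> generate ?P ?X"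
        using i.generate_img[of "{c}"] c that P.mono_generate[of "{(c, \<one>\<^bsub>D\<^esub>)}" ?X] by auto
      moreover have "(\<one>\<^bsub>C\<^esub>, y) \<in> generate ?P ?X"
        using j.generate_img[of "{d}"] d that P.mono_generate[of "{(\<one>\<^bsub>C\<^esub>, d)}" ?X] by auto
      ultimately have "(x, \<one>\<^bsub>D\<^esub>) \<otimes>\<^bsub>?P\<^esub> (\<one>\<^bsub>C\<^esub>, y) \<in> generate ?P ?X"
        by (rule gen.m_closed)
      then show ?thesis using that by simp
    qed
    then have "carrier ?P = generate ?P ?X"
      using gen.subset by auto
    moreover have "\<psi> ` carrier ?P = carrier Q"
      using \<psi> by (simp add: iso_def bij_betw_def)
    ultimately have "carrier Q = generate Q (\<psi> ` ?X)"
      using \<psi>.generate_img[OF X] by metis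
    moreover have "comm_group ?P"
      by (rule P.group_comm_groupI) (auto simp: C.m_comm D.m_comm)
    then have "comm_group Q"
      using comm_group.iso_imp_comm_group \<open>?P \<cong> Q\<close> Q.is_monoid by blast
    moreover have "\<psi> (c, \<one>\<^bsub>D\<^esub>) \<in> carrier Q" "\<psi> (\<one>\<^bsub>C\<^esub>, d) \<in> carrier Q"
      using X by (auto simp del: carrier_DirProd intro: \<psi>.hom_closed)
    ultimately show thesis
      using that by (simp only: image_insert image_empty)
  qed
qed

theorem theorem6p8:
  fixes A :: "('a, 'm) monoid_scheme" and Q :: "('b, 'n) monoid_scheme"
    and \<phi> :: "'b \<Rightarrow> 'a \<Rightarrow> 'a"
  assumes "comm_group A"
    and "bicyclic_group Q"
    and "\<phi> \<in> hom Q (AutoGroup A)"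
  shows "trivial_group (bogomolov_multiplier (semidirect_product A Q \<phi>))"
proof -
  obtain s t where "comm_group Q" "s \<in> carrier Q" "t \<in> carrier Q" "carrier Q = generate Q {s, t}"
    using assms(2) by (rule bicyclic_groupE)
  then show ?thesis
    by (intro abelian_by_bicyclic.trivial_bogomolov_multiplier[OF abelian_by_bicyclic_semidirect_product[OF assms(1) _ assms(3)]])
qed

end
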